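(* Assume that for every integer $r\geq 2$, all real zeros of $\zeta_r(s)$ in the interval $(0,1)$ are simple, and for each $2\leq k\leq r$ the number of zeros of $\zeta_r(s)$ in the open interval $(1/k,1/(k-1))$ equals $[r/k]$. Then, for every $r\geq 2$, the number $IAZ(r)$ of real zeros of $\zeta_r(s)$ in the interval $(0,1)$ satisfies $$IAZ(r)=\sum_{k=2}^r\left[\frac{r}{k}\right]=r\log r-2(1-\gamma)r+O(r^{1/2})\qquad (r\to\infty),$$ where $\gamma$ is Euler's constant.
   Context: For an integer $r\geq 1$ and $s\in\mathbb{C}$, $\zeta_r(s)=\zeta_r(s,s,\ldots,s)=\sum_{1\leq m_1<m_2<\cdots<m_r}(m_1m_2\cdots m_r)^{-s}$ is the Euler–Zagier $r$-fold zeta-function with all arguments equal; the series converges absolutely for $\Re s>1$, and $\zeta_r(s)$ is understood via its meromorphic continuation to $\mathbb{C}$ (its poles are at $s=1/k$, $1\leq k\leq r$). $[x]$ denotes the integer part of $x$. *)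

theory Defs
  imports "HOL-Complex_Analysis.Complex_Analysis" "HOL-Library.Landau_Symbols"
begin

definition EZ_indices :: "nat \<Rightarrow> nat list set" where
  "EZ_indices r = {ms. length ms = r \<and> sorted_wrt (<) ms \<and> (\<forall>m\<in>set ms. 1 \<le> m)}"

definition EZ_series :: "nat \<Rightarrow> complex \<Rightarrow> complex" where
  "EZ_series r s = (\<Sum>\<^sub>\<infinity>ms\<in>EZ_indices r. of_nat (prod_list ms) powr (-s))"

(* The meromorphic continuation of the series to the whole plane. It is unique by the
   identity theorem, because a nicely meromorphic function has its removable
   singularities removed and takes the value 0 at each of its poles. *)
definition EZ_zeta :: "nat \<Rightarrow> complex \<Rightarrow> complex" where
  "EZ_zeta r = (THE F. F nicely_meromorphic_on UNIV \<and> (\<forall>s. Re s > 1 \<longrightarrow> F s = EZ_series r s))"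

(* Poles are excluded explicitly, since EZ_zeta is 0 there by convention. *)
definition EZ_real_zeros :: "nat \<Rightarrow> real set \<Rightarrow> real set" where
  "EZ_real_zeros r I =
     {x \<in> I. EZ_zeta r (of_real x) = 0 \<and> \<not> is_pole (EZ_zeta r) (of_real x)}"

definition IAZ :: "nat \<Rightarrow> nat" where
  "IAZ r = card (EZ_real_zeros r {0<..<1})"

end

theory Submission
  imports Defs "HOL-Library.Discrete_Functions"
begin

text \<open>
  Newton's identities express \<open>r \<zeta>\<^sub>r(s)\<close> as \<open>\<Sum>\<^sub>j (-1)\<^sup>j\<^sup>-\<^sup>1 \<zeta>\<^sub>r\<^sub>-\<^sub>j(s) \<zeta>(j s)\<close>, which yields the continuation
  of \<open>\<zeta>\<^sub>r\<close> from that of \<open>\<zeta>\<close>. Since \<open>\<zeta> < 0\<close> on \<open>(0, 1)\<close> and the residue of \<open>\<zeta>\<close> at \<open>1\<close> is positive, all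
  summands that matter near a point of \<open>(0, 1/r)\<close> or near \<open>1/k\<close> have the same sign. Hence \<open>\<zeta>\<^sub>r\<close> has no
  zeros in \<open>(0, 1/r)\<close> and a pole of order \<open>[r/k]\<close> at \<open>1/k\<close>, so the zeros in \<open>(0, 1)\<close> all lie in the
  intervals \<open>(1/k, 1/(k-1))\<close> with \<open>2 \<le> k \<le> r\<close>. The asymptotics are Dirichlet's divisor estimate.
\<close>

subsection \<open>Continuation of the Riemann zeta function\<close>

text \<open>Unfolds to the sum of (-1)^i binomial(N, i) (x + i)^(-s). At the positive integers these
  iterated differences are the terms that Euler's transformation of the alternating series leaves
  after \<open>N\<close> steps.\<close>

fun pdiff :: "nat \<Rightarrow> complex \<Rightarrow> real \<Rightarrow> complex" where
  "pdiff 0 s x = of_real x powr (-s)"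
| "pdiff (Suc N) s x = pdiff N s x - pdiff N s (x + 1)"

text \<open>Differencing in \<open>x\<close> commutes with differentiation, so a derivative only
  multiplies by \<open>-s\<close> and shifts \<open>s\<close> by 1. This drives the induction in
  \<open>norm_pdiff_le\<close>.\<close>

lemma pdiff_has_vector_derivative:
  assumes "x > 0"
  shows "((\<lambda>x. pdiff N s x) has_vector_derivative (-s * pdiff N (s + 1) x)) (at x within A)"
  using assms
proof (induction N arbitrary: x A)
  case 0
  have "((\<lambda>z. z powr (-s)) has_field_derivative (-s) * of_real x powr (-s - 1)) (at (of_real x))"
    using 0 by (intro has_field_derivative_powr) auto
  then have "((\<lambda>x. of_real x powr (-s)) has_vector_derivative
               (-s) * of_real x powr (-s - 1)) (at x within A)"
    by (rule has_vector_derivative_real_field)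
  also have "-s - 1 = -(s + 1)" by simp
  finally show ?case by (simp only: pdiff.simps)
next
  case (Suc N)
  have shift: "((\<lambda>x. pdiff N s (x + 1)) has_vector_derivative (-s * pdiff N (s + 1) (x + 1))) (at x within A)"
  proof -
    have 1: "((\<lambda>x::real. x + 1) has_real_derivative 1) (at x within A)"
      by (auto intro!: derivative_eq_intros)
    have 2: "((\<lambda>x. pdiff N s x) has_vector_derivative (-s * pdiff N (s + 1) (x + 1)))
                (at (x + 1) within ((\<lambda>x. x + 1) ` A))"
      using Suc.IH[of "x + 1"] Suc.prems by auto
    have "(((\<lambda>x. pdiff N s x) \<circ> (\<lambda>x. x + 1)) has_vector_derivative
             1 *\<^sub>R (-s * pdiff N (s + 1) (x + 1))) (at x within A)"
      by (rule vector_diff_chain_within[OF _ 2])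
         (use 1 in \<open>simp add: has_real_derivative_iff_has_vector_derivative\<close>)
    then show ?thesis by (simp add: o_def)
  qed
  show ?case
    using has_vector_derivative_diff[OF Suc.IH[OF Suc.prems] shift] by (simp add: algebra_simps)
qed

text \<open>By the mean value inequality, a difference over a unit step is at most the maximal
  derivative on [x, x+1]; thus every difference gains a factor |s + i| / x. The lower bound on
  \<open>Re s\<close> keeps the exponent nonpositive, so that the left endpoint dominates.\<close>

lemma norm_pdiff_le:
  assumes "x > 0" "Re s + real N \<ge> 0"
  shows "norm (pdiff N s x) \<le> (\<Prod>i<N. norm (s + of_nat i)) * x powr (- Re s - real N)"
  using assms
proof (induction N arbitrary: x s)
  case 0
  then show ?case by (simp add: norm_powr_real_powr)
next
  case (Suc N)
  define B where "B = (\<Prod>i<Suc N. norm (s + of_nat i)) * x powr (- Re s - real (Suc N))"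
  have "norm (pdiff N s (x + 1) - pdiff N s x) \<le> B * norm ((x + 1) - x)"
  proof (rule differentiable_bound[where f = "\<lambda>x. pdiff N s x" and S = "{x..x+1}"
        and f' = "\<lambda>y h. h *\<^sub>R (-s * pdiff N (s + 1) y)"])
    fix y assume y: "y \<in> {x..x+1}"
    then show "((\<lambda>x. pdiff N s x) has_derivative (\<lambda>h. h *\<^sub>R (-s * pdiff N (s + 1) y))) (at y within {x..x+1})"
      using pdiff_has_vector_derivative[of y N s] Suc.prems by (auto simp: has_vector_derivative_def)
    have "norm (pdiff N (s + 1) y)
        \<le> (\<Prod>i<N. norm (s + 1 + of_nat i)) * y powr (- Re (s + 1) - real N)"
      using y Suc.prems by (intro Suc.IH) auto
    also have "\<dots> \<le> (\<Prod>i<N. norm (s + 1 + of_nat i)) * x powr (- Re (s + 1) - real N)"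
      using y Suc.prems by (intro mult_left_mono powr_mono2' prod_nonneg) auto
    finally have "norm s * norm (pdiff N (s + 1) y) \<le> norm s * \<dots>"
      by (intro mult_left_mono) auto
    also have "\<dots> = B"
    proof -
      have e: "- Re (s + 1) - real N = - Re s - real (Suc N)" by simp
      show ?thesis unfolding B_def prod.lessThan_Suc_shift e
        by (simp add: add.assoc mult.assoc)
    qed
    finally have "norm s * norm (pdiff N (s + 1) y) \<le> B" .
    then have "norm (h *\<^sub>R (-s * pdiff N (s + 1) y)) \<le> B * norm h" for h :: real
      using mult_right_mono[of "norm s * norm (pdiff N (s + 1) y)" B "norm h"]
      by (simp add: norm_mult mult.assoc mult.commute[of "\<bar>h\<bar>"])
    then show "onorm (\<lambda>h. h *\<^sub>R (-s * pdiff N (s + 1) y)) \<le> B"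
      by (rule onorm_le)
  qed auto
  then have "norm (pdiff (Suc N) s x) \<le> B"
    by (simp only: pdiff.simps norm_minus_commute[of "pdiff N s x"]) simp
  then show ?case unfolding B_def .
qed

lemma pdiff_holomorphic:
  assumes "x > 0"
  shows "(\<lambda>s. pdiff N s x) holomorphic_on A"
  using assms
proof (induction N arbitrary: x)
  case 0
  then show ?case by (simp add: holomorphic_intros)
next
  case (Suc N)
  then show ?case by (simp add: holomorphic_on_diff)
qed

text \<open>A majorant uniform in \<open>s\<close> over a disc cut with a half-plane, in the form
  that the Weierstrass M-test takes.\<close>

lemma norm_alternating_pdiff_le:
  assumes "norm s \<le> R" "\<sigma> \<le> Re s" "\<sigma> + real N \<ge> 0"
  shows "norm ((-1) ^ n * pdiff N s (real n + 1))
           \<le> (\<Prod>i<N. R + real i) * (real (Suc n)) powr (- \<sigma> - real N)"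
proof -
  have "norm (pdiff N s (real n + 1)) \<le> (\<Prod>i<N. norm (s + of_nat i)) * (real n + 1) powr (- Re s - real N)"
    using assms by (intro norm_pdiff_le) auto
  also have "\<dots> \<le> (\<Prod>i<N. R + real i) * (real (Suc n)) powr (- \<sigma> - real N)"
  proof (rule mult_mono)
    have "norm (s + of_nat i) \<le> R + real i" for i
      using norm_triangle_ineq[of s "of_nat i"] assms(1) by simp
    then show "(\<Prod>i<N. norm (s + of_nat i)) \<le> (\<Prod>i<N. R + real i)"
      by (intro prod_mono) auto
    show "0 \<le> (\<Prod>i<N. R + real i)"
      using order_trans[OF norm_ge_zero assms(1)] by (intro prod_nonneg) auto
    show "(real n + 1) powr (- Re s - real N) \<le> real (Suc n) powr (- \<sigma> - real N)"
      using assms(2) powr_mono[of "- Re s - real N" "- \<sigma> - real N" "real (Suc n)"]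
      by (simp add: add.commute)
  qed auto
  finally show ?thesis by (simp add: norm_mult norm_power)
qed

lemma summable_real_powr_Suc:
  assumes "a < -1"
  shows "summable (\<lambda>n. real (Suc n) powr a)"
  using assms by (subst summable_Suc_iff) (simp add: summable_real_powr_iff)

text \<open>
  The alternating series \<open>\<Sum>(-1)\<^sup>n (n+1)\<^sup>-\<^sup>s\<close> after \<open>N\<close> steps of the rearrangement
  \<open>\<Sum>(-1)\<^sup>n a\<^sub>n = a\<^sub>0/2 + (1/2) \<Sum>(-1)\<^sup>n (a\<^sub>n - a\<^sub>n\<^sub>+\<^sub>1)\<close>; each step moves the abscissa of convergence
  one unit to the left.
\<close>
definition eta_accel :: "nat \<Rightarrow> complex \<Rightarrow> complex" where
  "eta_accel N s = (\<Sum>i<N. pdiff i s 1 / 2 ^ Suc i) + (\<Sum>n. (-1) ^ n * pdiff N s (real n + 1)) / 2 ^ N"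

lemma summable_norm_alternating_pdiff:
  assumes "Re s + real N > 1"
  shows "summable (\<lambda>n. norm ((-1) ^ n * pdiff N s (real n + 1)))"
proof (rule summable_comparison_test')
  show "summable (\<lambda>n. (\<Prod>i<N. norm s + real i) * real (Suc n) powr (- Re s - real N))"
    using assms by (intro summable_mult summable_real_powr_Suc) auto
  show "norm (norm ((-1) ^ n * pdiff N s (real n + 1)))
      \<le> (\<Prod>i<N. norm s + real i) * real (Suc n) powr (- Re s - real N)" for n
    using norm_alternating_pdiff_le[of s "norm s" "Re s" N n] assms by simp
qed

lemma eta_accel_holomorphic: "eta_accel N holomorphic_on {s. Re s > 1 - real N}"
proof -
  let ?S = "{s. Re s > 1 - real N}"
  have "(\<lambda>s. \<Sum>n. (-1) ^ n * pdiff N s (real n + 1)) holomorphic_on ?S"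
  proof (rule holomorphic_uniform_sequence)
    show "open ?S" by (simp add: open_halfspace_Re_gt)
    show "(\<lambda>s. \<Sum>n<m. (-1) ^ n * pdiff N s (real n + 1)) holomorphic_on ?S" for m
      by (intro holomorphic_intros pdiff_holomorphic) auto
    fix s assume "s \<in> ?S"
    \<comment> \<open>Half the distance to the boundary line: on the closed disc of this radius the
      majorant is a constant times (n+1)^(-1-d), which is summable.\<close>
    define d where "d = (Re s - (1 - real N)) / 2"
    have d: "d > 0" using \<open>s \<in> ?S\<close> by (simp add: d_def)
    have re: "Re z \<ge> 1 - real N + d" if "z \<in> cball s d" for z
    proof -
      have "Re s - Re z \<le> d"
        using that complex_Re_le_cmod[of "s - z"] by (auto simp: dist_norm)
      then show ?thesis unfolding d_def by (simp add: field_simps)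
    qed
    have nrm: "norm z \<le> norm s + d" if "z \<in> cball s d" for z
      using that norm_triangle_ineq2[of z s] by (auto simp: dist_norm norm_minus_commute)
    have "uniform_limit (cball s d) (\<lambda>m s. \<Sum>n<m. (-1) ^ n * pdiff N s (real n + 1))
            (\<lambda>s. \<Sum>n. (-1) ^ n * pdiff N s (real n + 1)) sequentially"
    proof (rule Weierstrass_m_test)
      show "norm ((-1) ^ n * pdiff N z (real n + 1))
              \<le> (\<Prod>i<N. (norm s + d) + real i) * real (Suc n) powr (- (1 - real N + d) - real N)"
        if "z \<in> cball s d" for n z
        using re[OF that] nrm[OF that] d by (intro norm_alternating_pdiff_le) auto
      show "summable (\<lambda>n. (\<Prod>i<N. (norm s + d) + real i) * real (Suc n) powr (- (1 - real N + d) - real N))"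
        using d by (intro summable_mult summable_real_powr_Suc) auto
    qed
    with d re show "\<exists>d>0. cball s d \<subseteq> ?S \<and> uniform_limit (cball s d)
        (\<lambda>m s. \<Sum>n<m. (-1) ^ n * pdiff N s (real n + 1))
            (\<lambda>s. \<Sum>n. (-1) ^ n * pdiff N s (real n + 1)) sequentially"
      by (intro exI[of _ d]) fastforce
  qed
  then show ?thesis unfolding eta_accel_def
    by (intro holomorphic_intros pdiff_holomorphic) auto
qed

lemma eta_accel_Suc:
  assumes "Re s + real N > 1"
  shows "eta_accel (Suc N) s = eta_accel N s"
proof -
  define a where "a = (\<lambda>n. (-1) ^ n * pdiff N s (real n + 1))"
  have a: "summable a"
    unfolding a_def using summable_norm_alternating_pdiff[OF assms] by (rule summable_norm_cancel)
  \<comment> \<open>One more difference pairs each term with its successor, so the new sum is twice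
    the old one minus its first term.\<close>
  have "(-1) ^ n * pdiff (Suc N) s (real n + 1) = a n + a (Suc n)" for n
    by (simp add: a_def algebra_simps)
  then have "(\<Sum>n. (-1) ^ n * pdiff (Suc N) s (real n + 1)) = suminf a + (\<Sum>n. a (Suc n))"
    using suminf_add[OF a] a summable_Suc_iff[of a] by simp
  also have "\<dots> = 2 * suminf a - pdiff N s 1"
    using suminf_split_head[OF a] by (simp add: a_def)
  finally have *: "(\<Sum>n. (-1) ^ n * pdiff (Suc N) s (real n + 1)) = 2 * suminf a - pdiff N s 1" .
  show ?thesis
    unfolding eta_accel_def * by (simp add: a_def field_simps)
qed

lemma eta_accel_eq:
  assumes "Re s + real N > 1" "N \<le> M"
  shows "eta_accel M s = eta_accel N s"
  using assms(2) by (induction rule: dec_induct) (use assms(1) in \<open>auto simp: eta_accel_Suc\<close>)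

text \<open>Dirichlet's eta function as an entire function. Since \<open>Re s\<close> is at least
  -|s|, the chosen order always puts \<open>s\<close> inside the half-plane of convergence; by
  \<open>eta_accel_eq\<close> the value does not depend on which admissible order is taken.\<close>

definition dir_eta :: "complex \<Rightarrow> complex" where
  "dir_eta s = eta_accel (nat \<lceil>norm s\<rceil> + 2) s"

lemma dir_eta_eq:
  assumes "Re s + real N > 1"
  shows "dir_eta s = eta_accel N s"
proof -
  let ?M = "nat \<lceil>norm s\<rceil> + 2"
  have "Re s + real ?M > 1"
    using abs_Re_le_cmod[of s] real_nat_ceiling_ge[of "norm s"] by simp linarith
  then show ?thesis
    using eta_accel_eq[of s N ?M] eta_accel_eq[of s ?M N] assms unfolding dir_eta_def
    by (cases "N \<le> ?M") auto
qed

text \<open>The order in \<open>dir_eta\<close> jumps with \<open>s\<close>, but on a whole open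
  half-plane around a given point the function equals a single \<open>eta_accel N\<close>.\<close>

lemma dir_eta_holomorphic: "dir_eta holomorphic_on UNIV"
proof -
  have "dir_eta analytic_on {s}" for s
  proof -
    define N where "N = nat \<lceil>norm s\<rceil> + 2"
    have "Re s + real N > 1"
      using abs_Re_le_cmod[of s] real_nat_ceiling_ge[of "norm s"] unfolding N_def by simp linarith
    moreover have "dir_eta holomorphic_on {s. Re s > 1 - real N}"
      using eta_accel_holomorphic[of N] by (rule holomorphic_transform)
        (use dir_eta_eq[of _ N] in \<open>auto simp: algebra_simps\<close>)
    ultimately show ?thesis
      unfolding analytic_at by (intro exI[of _ "{s. Re s > 1 - real N}"]) (auto simp: open_halfspace_Re_gt)
  qed
  then have "dir_eta analytic_on UNIV" by (subst analytic_on_analytic_at) auto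
  then show ?thesis by (rule analytic_imp_holomorphic)
qed

lemma dir_eta_sums:
  assumes "Re s > 1"
  shows "(\<lambda>n. (-1) ^ n * of_nat (Suc n) powr (-s)) sums dir_eta s"
  using summable_sums[OF summable_norm_cancel[OF summable_norm_alternating_pdiff[of s 0]]] assms
    dir_eta_eq[of s 0] by (simp add: eta_accel_def add.commute)

text \<open>
  The zeros of the denominator on \<open>Re s = 1\<close> other than \<open>s = 1\<close> are removable, but only meromorphy
  and the behaviour on the real axis and on \<open>Re s > 1\<close> matter below.
\<close>
definition zeta_cont :: "complex \<Rightarrow> complex" where
  "zeta_cont s = dir_eta s / (1 - 2 powr (1 - s))"

lemma two_powr_neq_1:
  assumes "Re s > 1 \<or> (s \<in> \<real> \<and> s \<noteq> 1)"
  shows "1 - 2 powr (1 - s) \<noteq> 0"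
proof
  assume "1 - 2 powr (1 - s) = 0"
  then have "norm (2 powr (1 - s)) = 1" by simp
  then have "2 powr (1 - Re s) = (1::real)"
    using norm_powr_real_powr[of 2 "1 - s"] by simp
  then have "Re s = 1" by (simp add: powr_eq_one_iff_gen)
  with assms show False by (auto elim!: Reals_cases)
qed

lemma zeta_cont_meromorphic: "zeta_cont meromorphic_on UNIV"
proof -
  have "dir_eta meromorphic_on UNIV"
    using dir_eta_holomorphic by (intro analytic_on_imp_meromorphic_on) (simp add: analytic_on_open)
  moreover have "(\<lambda>s. 1 - 2 powr (1 - s)) meromorphic_on UNIV"
    by (intro analytic_on_imp_meromorphic_on) (simp add: analytic_on_open holomorphic_intros)
  ultimately show ?thesis
    unfolding zeta_cont_def by (rule meromorphic_on_divide)
qed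

lemma zeta_cont_analytic:
  assumes "Re s > 1 \<or> (s \<in> \<real> \<and> s \<noteq> 1)"
  shows "zeta_cont analytic_on {s}"
proof -
  have "dir_eta analytic_on UNIV"
    using dir_eta_holomorphic by (simp add: analytic_on_open)
  then have "dir_eta analytic_on {s}" by (rule analytic_on_subset) auto
  then show ?thesis
    unfolding zeta_cont_def using two_powr_neq_1[OF assms] by (auto intro!: analytic_intros)
qed

text \<open>Subtracting the alternating series from the full one leaves twice the terms at even
  integers, which is 2^(1-s) times the full series. Solving for the latter gives the quotient
  defining \<open>zeta_cont\<close>.\<close>

lemma zeta_cont_sums:
  assumes s: "Re s > 1"
  shows "(\<lambda>n. of_nat (Suc n) powr (-s)) sums zeta_cont s"
proof -
  define f where "f = (\<lambda>n. of_nat (Suc n) powr (-s) :: complex)"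
  have f: "summable f"
  proof (rule summable_norm_cancel)
    show "summable (\<lambda>n. norm (f n))"
      using summable_norm_alternating_pdiff[of s 0] s by (simp add: f_def norm_mult norm_power add.commute)
  qed
  have f2: "f (2 * n + 1) = 2 powr (-s) * f n" for n
  proof -
    have "f (2 * n + 1) = (of_real 2 * of_real (real (Suc n))) powr (-s)"
      by (simp add: f_def algebra_simps)
    also have "\<dots> = of_real 2 powr (-s) * of_real (real (Suc n)) powr (-s)"
      by (rule powr_times_real) auto
    finally show ?thesis by (simp add: f_def)
  qed
  have "(\<lambda>n. f n - (-1) ^ n * f n) sums (suminf f - dir_eta s)"
    using sums_diff[OF summable_sums[OF f] dir_eta_sums[OF s]] by (simp add: f_def)
  then have "(\<lambda>m. \<Sum>n<m. f n - (-1) ^ n * f n) \<longlonglongrightarrow> suminf f - dir_eta s"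
    by (simp add: sums_def)
  \<comment> \<open>Even cut-offs contain complete pairs, so these partial sums are exact multiples
    of the partial sums of \<open>f\<close>.\<close>
  then have "(\<lambda>m. \<Sum>n<m*2. f n - (-1) ^ n * f n) \<longlonglongrightarrow> suminf f - dir_eta s"
    by (rule LIMSEQ_linear) simp
  moreover have "(\<Sum>n<m*2. f n - (-1) ^ n * f n) = 2 * 2 powr (-s) * (\<Sum>n<m. f n)" for m
    by (induction m) (use f2 in \<open>auto simp: algebra_simps\<close>)
  ultimately have "(\<lambda>m. 2 * 2 powr (-s) * (\<Sum>n<m. f n)) \<longlonglongrightarrow> suminf f - dir_eta s" by simp
  moreover have "(\<lambda>m. 2 * 2 powr (-s) * (\<Sum>n<m. f n)) \<longlonglongrightarrow> 2 * 2 powr (-s) * suminf f"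
    using summable_LIMSEQ[OF f] by (intro tendsto_intros)
  ultimately have "suminf f - dir_eta s = 2 * 2 powr (-s) * suminf f"
    by (rule LIMSEQ_unique)
  also have "2 * 2 powr (-s) = (2 powr (1 - s) :: complex)"
    by (simp add: powr_diff powr_minus field_simps)
  finally have "suminf f * (1 - 2 powr (1 - s)) = dir_eta s" by (simp add: algebra_simps)
  then have "suminf f = zeta_cont s"
    using two_powr_neq_1[of s] s by (simp add: zeta_cont_def field_simps)
  then show ?thesis using summable_sums[OF f] by (simp add: f_def)
qed

text \<open>One accelerated step represents eta for all x > 0 as half of 1 plus the alternating sum
  of \<open>d n\<close>. The \<open>d n\<close> are positive and telescope to 1, so writing 1 as
  their sum cancels the odd terms and doubles the even ones, leaving at least
  \<open>2 * d 0\<close>.\<close>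

lemma dir_eta_pos:
  assumes "x > 0"
  shows "\<exists>y>0. dir_eta (of_real x) = of_real y"
proof -
  define d where "d n = real (Suc n) powr (-x) - real (Suc (Suc n)) powr (-x)" for n
  have pos: "d n > 0" for n
    unfolding d_def using assms by (simp add: powr_less_mono2_neg)
  have p: "pdiff (Suc 0) (of_real x) (real n + 1) = of_real (d n)" for n
    using powr_of_real[of "real n + 1" "-x"] powr_of_real[of "real n + 2" "-x"]
    by (simp add: d_def add_ac)
  have "(\<lambda>n. real (Suc n) powr (-x)) \<longlonglongrightarrow> 0"
    using assms by real_asymp
  from telescope_sums'[OF this] have d1: "d sums 1" unfolding d_def by simp
  have "summable (\<lambda>n. (-1) ^ n * d n)"
    by (rule summable_comparison_test'[OF sums_summable[OF d1]])
       (use pos in \<open>auto simp: norm_mult abs_mult less_imp_le\<close>)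
  then have alt: "(\<lambda>n. (-1) ^ n * d n) sums (\<Sum>n. (-1) ^ n * d n)" by (rule summable_sums)
  from sums_add[OF this d1] have "(\<lambda>n. (-1) ^ n * d n + d n) sums ((\<Sum>n. (-1) ^ n * d n) + 1)" .
  moreover have "(-1) ^ n * d n + d n \<ge> (if n = 0 then 2 * d 0 else 0)" for n
    using pos[of n] by (cases "even n") auto
  moreover have "(\<lambda>n. if n = 0 then 2 * d 0 else 0) sums (2 * d 0)"
    using sums_If_finite[of "\<lambda>n. n = 0" "\<lambda>_. 2 * d 0"] by simp
  ultimately have ge: "2 * d 0 \<le> (\<Sum>n. (-1) ^ n * d n) + 1"
    by (meson sums_le)
  have "dir_eta (of_real x) = eta_accel 1 (of_real x)"
    using assms by (intro dir_eta_eq) auto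
  also have "\<dots> = 1 / 2 + (\<Sum>n. of_real ((-1) ^ n * d n)) / 2"
    unfolding eta_accel_def using p by simp
  also have "(\<Sum>n. of_real ((-1) ^ n * d n)) = (of_real (\<Sum>n. (-1) ^ n * d n) :: complex)"
    using alt by (metis sums_of_real sums_unique)
  finally have "dir_eta (of_real x) = of_real ((1 + (\<Sum>n. (-1) ^ n * d n)) / 2)"
    by simp
  with ge pos[of 0] show ?thesis by (intro exI[of _ "(1 + (\<Sum>n. (-1) ^ n * d n)) / 2"]) auto
qed

text \<open>The numerator \<open>dir_eta\<close> is positive, and the denominator is negative
  because 2^(1-x) > 1.\<close>

lemma zeta_cont_neg:
  assumes "0 < x" "x < 1"
  shows "\<exists>y<0. zeta_cont (of_real x) = of_real y"
proof -
  obtain y where y: "y > 0" "dir_eta (of_real x) = of_real y" using dir_eta_pos[OF assms(1)] by auto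
  have "(2::real) powr (1 - x) > 1" using assms by simp
  then have "y / (1 - 2 powr (1 - x)) < 0" using y by (simp add: divide_pos_neg)
  moreover have "zeta_cont (of_real x) = of_real (y / (1 - 2 powr (1 - x)))"
    using powr_of_real[of 2 "1 - x"] y by (simp add: zeta_cont_def)
  ultimately show ?thesis by blast
qed

text \<open>The denominator has a simple zero at 1 with derivative \<open>ln 2\<close>, which gives
  \<open>c = dir_eta 1 / ln 2\<close>.\<close>

lemma zeta_cont_pole:
  "\<exists>c>0. ((\<lambda>s. (s - 1) * zeta_cont s) \<longlongrightarrow> complex_of_real c) (at 1)"
proof -
  obtain y where y: "y > 0" "dir_eta 1 = of_real y" using dir_eta_pos[of 1] by auto
  have "((\<lambda>s. 1 - 2 powr (1 - s)) has_field_derivative (of_real (ln 2))) (at (1::complex))"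
    using Ln_of_real[of 2] by (auto simp: powr_def intro!: derivative_eq_intros)
  then have "((\<lambda>s. (1 - 2 powr (1 - s)) / (s - 1)) \<longlongrightarrow> complex_of_real (ln 2)) (at 1)"
    by (simp add: has_field_derivative_iff)
  moreover have "(dir_eta \<longlongrightarrow> dir_eta 1) (at 1)"
    using dir_eta_holomorphic by (metis UNIV_I continuous_on_eq_continuous_at holomorphic_on_imp_continuous_on isCont_def open_UNIV)
  ultimately have "((\<lambda>s. dir_eta s / ((1 - 2 powr (1 - s)) / (s - 1))) \<longlongrightarrow> of_real y / complex_of_real (ln 2)) (at 1)"
    using y by (intro tendsto_divide) auto
  then have "((\<lambda>s. (s - 1) * zeta_cont s) \<longlongrightarrow> of_real (y / ln 2)) (at 1)"
    by (simp add: zeta_cont_def mult.commute)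
  with y show ?thesis by (intro exI[of _ "y / ln 2"]) auto
qed

subsection \<open>Newton's identities and the multiple series\<close>

text \<open>Elementary symmetric polynomials in the first \<open>M\<close> variables, split by
  whether a monomial contains the last variable.\<close>

fun esym :: "nat \<Rightarrow> (nat \<Rightarrow> 'a::comm_ring_1) \<Rightarrow> nat \<Rightarrow> 'a" where
  "esym 0 x M = 1"
| "esym (Suc r) x 0 = 0"
| "esym (Suc r) x (Suc M) = esym (Suc r) x M + x M * esym r x M"

text \<open>Induction on the number of variables. A new variable adds \<open>x M * e (k - 1)\<close>
  to the k-th symmetric polynomial and a power of \<open>x M\<close> to each power sum; the old
  identities for \<open>n + 1\<close> and \<open>n\<close> account for all but a telescoping
  sum.\<close>

lemma newton_identity:
  "of_nat r * esym r x M = (\<Sum>j<r. (-1) ^ j * esym (r - Suc j) x M * (\<Sum>i<M. x i ^ Suc j))"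
proof (induction M arbitrary: r)
  case 0
  then show ?case by (cases r) auto
next
  case (Suc M)
  show ?case
  proof (cases r)
    case (Suc n)
    define e where "e k = esym k x M" for k
    \<comment> \<open>The predecessor of \<open>e k\<close> with value 0 at \<open>k = 0\<close>;
      truncated subtraction alone would give \<open>e 0\<close> there.\<close>
    define g where "g k = (if k = 0 then 0 else e (k - 1))" for k
    define p where "p j = (\<Sum>i<M. x i ^ j)" for j
    define t where "t j = (-1) ^ j * x M ^ Suc j * e (n - j)" for j
    have e': "esym k x (Suc M) = e k + x M * g k" for k
      by (cases k) (simp_all add: e_def g_def)
    have A: "(\<Sum>j<Suc n. (-1) ^ j * e (n - j) * p (Suc j)) = of_nat (Suc n) * e (Suc n)"
      using Suc.IH[of "Suc n"] by (simp only: e_def p_def diff_Suc_Suc)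
    have "(\<Sum>j<Suc n. (-1) ^ j * g (n - j) * p (Suc j)) = (\<Sum>j<n. (-1) ^ j * g (n - j) * p (Suc j))"
      by (simp add: g_def)
    also have "\<dots> = (\<Sum>j<n. (-1) ^ j * e (n - Suc j) * p (Suc j))"
      by (intro sum.cong refl) (auto simp: g_def)
    also have "\<dots> = of_nat n * e n"
      using Suc.IH[of n] by (simp only: e_def p_def)
    finally have B: "(\<Sum>j<Suc n. (-1) ^ j * g (n - j) * p (Suc j)) = of_nat n * e n" .
    have "(\<Sum>j<Suc n. (-1) ^ j * (e (n - j) + x M * g (n - j)) * x M ^ Suc j)
        = (\<Sum>j<n. t j - t (Suc j)) + t n"
    proof -
      have "(\<Sum>j<n. (-1) ^ j * (e (n - j) + x M * g (n - j)) * x M ^ Suc j)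
          = (\<Sum>j<n. t j - t (Suc j))"
        by (intro sum.cong refl) (auto simp: t_def g_def algebra_simps)
      moreover have "(-1) ^ n * (e (n - n) + x M * g (n - n)) * x M ^ Suc n = t n"
        by (simp add: t_def g_def mult_ac)
      ultimately show ?thesis by (simp only: sum.lessThan_Suc)
    qed
    also have "\<dots> = x M * e n"
      unfolding sum_lessThan_telescope' by (simp add: t_def)
    finally have C: "(\<Sum>j<Suc n. (-1) ^ j * (e (n - j) + x M * g (n - j)) * x M ^ Suc j) = x M * e n" .
    have "(\<Sum>j<Suc n. (-1) ^ j * esym (n - j) x (Suc M) * (\<Sum>i<Suc M. x i ^ Suc j))
        = (\<Sum>j<Suc n. (-1) ^ j * (e (n - j) + x M * g (n - j)) * (p (Suc j) + x M ^ Suc j))"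
      by (simp only: e' p_def sum.lessThan_Suc[of _ M])
    also have "\<dots> = (\<Sum>j<Suc n. (-1) ^ j * e (n - j) * p (Suc j)) + x M * (\<Sum>j<Suc n. (-1) ^ j * g (n - j) * p (Suc j))
        + (\<Sum>j<Suc n. (-1) ^ j * (e (n - j) + x M * g (n - j)) * x M ^ Suc j)"
      unfolding sum_distrib_left sum.distrib[symmetric]
      by (intro sum.cong refl) (simp add: algebra_simps)
    also have "\<dots> = of_nat (Suc n) * (e (Suc n) + x M * e n)"
      unfolding A B C by (simp add: algebra_simps)
    finally show ?thesis
      unfolding Suc by (simp add: e_def)
  qed simp
qed

text \<open>Every monomial of the symmetric polynomial occurs in the expanded power. This bounds the
  truncated sums independently of \<open>M\<close> once the variables are summable.\<close>

lemma esym_le_power: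
  fixes x :: "nat \<Rightarrow> real"
  assumes "\<And>i. x i \<ge> 0"
  shows "esym r x M \<le> (\<Sum>i<M. x i) ^ r"
  using assms
proof (induction r x M rule: esym.induct)
  case (3 r x M)
  define S where "S = (\<Sum>i<M. x i)"
  have S: "S \<ge> 0" unfolding S_def using 3 by (intro sum_nonneg) auto
  have "esym (Suc r) x (Suc M) \<le> S ^ Suc r + x M * S ^ r"
    using 3 unfolding esym.simps S_def by (intro add_mono mult_left_mono) auto
  also have "\<dots> = (S + x M) * S ^ r" by (simp add: algebra_simps)
  also have "\<dots> \<le> (S + x M) * (S + x M) ^ r"
    using S 3 by (intro mult_left_mono power_mono) auto
  finally show ?case by (simp add: S_def)
qed auto

definition bounded_indices :: "nat \<Rightarrow> nat \<Rightarrow> nat list set" where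
  "bounded_indices r M = {ms \<in> EZ_indices r. set ms \<subseteq> {..M}}"

lemma finite_bounded_indices: "finite (bounded_indices r M)"
  by (rule finite_subset[OF _ finite_lists_length_eq[of "{..M}" r]])
     (auto simp: bounded_indices_def EZ_indices_def)

text \<open>A strictly increasing list can contain its upper bound only as the last entry. The
  resulting split mirrors the recursion of \<open>esym\<close>.\<close>

lemma bounded_indices_Suc:
  "bounded_indices (Suc r) (Suc M) =
     bounded_indices (Suc r) M \<union> (\<lambda>ms. ms @ [Suc M]) ` bounded_indices r M"
proof (intro equalityI subsetI)
  fix ms assume ms: "ms \<in> bounded_indices (Suc r) (Suc M)"
  then obtain ys y where "ms = ys @ [y]"
    by (cases ms rule: rev_cases) (auto simp: bounded_indices_def EZ_indices_def)
  with ms show "ms \<in> bounded_indices (Suc r) M \<union> (\<lambda>ms. ms @ [Suc M]) ` bounded_indices r M"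
    by (cases "y = Suc M")
       (fastforce simp: bounded_indices_def EZ_indices_def sorted_wrt_append)+
next
  fix ms assume "ms \<in> bounded_indices (Suc r) M \<union> (\<lambda>ms. ms @ [Suc M]) ` bounded_indices r M"
  then show "ms \<in> bounded_indices (Suc r) (Suc M)"
    by (fastforce simp: bounded_indices_def EZ_indices_def sorted_wrt_append)
qed

lemma sum_bounded_indices:
  fixes f :: "nat \<Rightarrow> 'a::comm_ring_1"
  shows "(\<Sum>ms\<in>bounded_indices r M. prod_list (map f ms)) = esym r (\<lambda>i. f (Suc i)) M"
proof (induction r "\<lambda>i. f (Suc i)" M rule: esym.induct)
  case (1 M)
  have "bounded_indices 0 M = {[]}" by (auto simp: bounded_indices_def EZ_indices_def)
  then show ?case by simp
next
  case (2 r)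
  have "bounded_indices (Suc r) 0 = {}"
    by (fastforce simp: bounded_indices_def EZ_indices_def length_Suc_conv)
  then show ?case by simp
next
  case (3 r M)
  have "bounded_indices (Suc r) M \<inter> (\<lambda>ms. ms @ [Suc M]) ` bounded_indices r M = {}"
    by (auto simp: bounded_indices_def)
  then have "(\<Sum>ms\<in>bounded_indices (Suc r) (Suc M). prod_list (map f ms))
     = (\<Sum>ms\<in>bounded_indices (Suc r) M. prod_list (map f ms))
       + (\<Sum>ms\<in>(\<lambda>ms. ms @ [Suc M]) ` bounded_indices r M. prod_list (map f ms))"
    unfolding bounded_indices_Suc by (intro sum.union_disjoint finite_imageI finite_bounded_indices)
  also have "(\<Sum>ms\<in>(\<lambda>ms. ms @ [Suc M]) ` bounded_indices r M. prod_list (map f ms))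
     = f (Suc M) * (\<Sum>ms\<in>bounded_indices r M. prod_list (map f ms))"
    by (subst sum.reindex) (auto simp: inj_on_def sum_distrib_left mult.commute)
  finally show ?case using 3 by simp
qed

lemma eventually_subset_bounded_indices:
  assumes "finite F" "F \<subseteq> EZ_indices r"
  shows "eventually (\<lambda>M. F \<subseteq> bounded_indices r M) sequentially"
proof -
  have "finite (\<Union>ms\<in>F. set ms)" using assms by auto
  then obtain B where "(\<Union>ms\<in>F. set ms) \<subseteq> {..B}"
    using finite_nat_set_iff_bounded_le by (metis atMost_iff subsetI)
  then have "F \<subseteq> bounded_indices r M" if "M \<ge> B" for M
    using assms that by (fastforce simp: bounded_indices_def)
  then show ?thesis by (auto simp: eventually_sequentially)
qed

text \<open>Every finite index set lies in some \<open>bounded_indices r M\<close>, so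
  \<open>esym_le_power\<close> bounds all finite sums of norms by \<open>S ^ r\<close>. Absolute
  convergence then lets the unordered sum be computed along this exhaustion.\<close>

lemma esym_tendsto_infsum:
  fixes f :: "nat \<Rightarrow> complex"
  assumes "summable (\<lambda>i. norm (f (Suc i)))"
  shows "(\<lambda>M. esym r (\<lambda>i. f (Suc i)) M) \<longlonglongrightarrow> (\<Sum>\<^sub>\<infinity>ms\<in>EZ_indices r. prod_list (map f ms))"
proof -
  define S where "S = (\<Sum>i. norm (f (Suc i)))"
  have norm_prod: "norm (prod_list (map f ms)) = prod_list (map (\<lambda>i. norm (f i)) ms)" for ms
    by (induction ms) (auto simp: norm_mult)
  have "(\<lambda>ms. norm (prod_list (map f ms))) summable_on EZ_indices r"
  proof (rule nonneg_bdd_above_summable_on)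
    show "bdd_above (sum (\<lambda>ms. norm (prod_list (map f ms))) ` {F. F \<subseteq> EZ_indices r \<and> finite F})"
    proof (rule bdd_aboveI2)
      fix F assume "F \<in> {F. F \<subseteq> EZ_indices r \<and> finite F}"
      then obtain M where M: "F \<subseteq> bounded_indices r M"
        using eventually_subset_bounded_indices[of F r] by (auto simp: eventually_sequentially)
      have "(\<Sum>ms\<in>F. norm (prod_list (map f ms))) \<le> (\<Sum>ms\<in>bounded_indices r M. norm (prod_list (map f ms)))"
        using M by (intro sum_mono2 finite_bounded_indices) auto
      also have "\<dots> = esym r (\<lambda>i. norm (f (Suc i))) M"
        unfolding norm_prod by (rule sum_bounded_indices)
      also have "\<dots> \<le> (\<Sum>i<M. norm (f (Suc i))) ^ r"
        using esym_le_power[of "\<lambda>i. norm (f (Suc i))" r M] by simp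
      also have "\<dots> \<le> S ^ r"
        unfolding S_def using assms by (intro power_mono sum_le_suminf sum_nonneg) auto
      finally show "(\<Sum>ms\<in>F. norm (prod_list (map f ms))) \<le> S ^ r" .
    qed
  qed auto
  then have "((\<lambda>ms. prod_list (map f ms)) has_sum (\<Sum>\<^sub>\<infinity>ms\<in>EZ_indices r. prod_list (map f ms))) (EZ_indices r)"
    by (rule has_sum_infsum[OF abs_summable_summable])
  then have "(sum (\<lambda>ms. prod_list (map f ms)) \<longlongrightarrow> (\<Sum>\<^sub>\<infinity>ms\<in>EZ_indices r. prod_list (map f ms)))
      (finite_subsets_at_top (EZ_indices r))"
    by (simp add: has_sum_def)
  moreover have "filterlim (bounded_indices r) (finite_subsets_at_top (EZ_indices r)) sequentially"
    unfolding filterlim_finite_subsets_at_top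
    using eventually_subset_bounded_indices[of _ r] finite_bounded_indices
    by (auto simp: bounded_indices_def elim: eventually_mono)
  ultimately have "(\<lambda>M. \<Sum>ms\<in>bounded_indices r M. prod_list (map f ms))
      \<longlonglongrightarrow> (\<Sum>\<^sub>\<infinity>ms\<in>EZ_indices r. prod_list (map f ms))"
    by (rule filterlim_compose)
  then show ?thesis by (simp only: sum_bounded_indices)
qed

lemma of_nat_prod_list_powr:
  "of_nat (prod_list ms) powr s = prod_list (map (\<lambda>m. of_nat m powr s) ms)" for s :: complex
proof (induction ms)
  case (Cons m ms)
  have "of_nat (prod_list (m # ms)) powr s = (of_real (real m) * of_real (real (prod_list ms))) powr s"
    by simp
  also have "\<dots> = of_nat m powr s * of_nat (prod_list ms) powr s"
    by (subst powr_times_real) auto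
  finally show ?case using Cons by simp
qed simp

subsection \<open>Continuation of the multiple zeta functions\<close>

text \<open>Newton's identity solved for its leading term, with the j-th power sum replaced by zeta
  at j times \<open>s\<close>. Values at singular points are artefacts of division by zero;
  \<open>EZ_zeta_eq\<close> repairs them with \<open>remove_sings\<close>.\<close>

fun multi_zeta :: "nat \<Rightarrow> complex \<Rightarrow> complex" where
  "multi_zeta 0 s = 1"
| "multi_zeta (Suc r) s =
     (\<Sum>j<Suc r. (-1) ^ j * multi_zeta (r - j) s * zeta_cont (of_nat (Suc j) * s)) / of_nat (Suc r)"

declare multi_zeta.simps(2) [simp del]

text \<open>Letting \<open>M\<close> tend to infinity in Newton's identity for the variables m^(-s)
  shows that the series satisfy the recursion defining \<open>multi_zeta\<close>.\<close>

lemma multi_zeta_eq_series: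
  assumes s: "Re s > 1"
  shows "multi_zeta r s = EZ_series r s"
proof -
  define f where "f = (\<lambda>m::nat. of_nat m powr (-s))"
  have EZ: "EZ_series r s = (\<Sum>\<^sub>\<infinity>ms\<in>EZ_indices r. prod_list (map f ms))" for r
    unfolding EZ_series_def f_def of_nat_prod_list_powr ..
  have "summable (\<lambda>i. norm (f (Suc i)))"
    using summable_norm_alternating_pdiff[of s 0] s
    by (simp add: f_def norm_mult norm_power add.commute)
  from esym_tendsto_infsum[OF this]
  have lim: "(\<lambda>M. esym r (\<lambda>i. f (Suc i)) M) \<longlonglongrightarrow> EZ_series r s" for r
    unfolding EZ .
  have pw: "f m ^ j = of_nat m powr (- (of_nat j * s))" if "j > 0" for m j
    using that by (cases "m = 0") (simp_all add: f_def powr_def exp_of_nat_mult[symmetric] algebra_simps)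
  have p: "(\<lambda>M. \<Sum>i<M. f (Suc i) ^ Suc j) \<longlonglongrightarrow> zeta_cont (of_nat (Suc j) * s)" for j
  proof -
    have "1 * 1 < real (Suc j) * Re s"
      using s by (intro mult_le_less_imp_less) auto
    then have "Re (of_nat (Suc j) * s) > 1" by simp
    from zeta_cont_sums[OF this] show ?thesis
      by (simp only: sums_def pw zero_less_Suc)
  qed
  have rec: "of_nat (Suc r) * EZ_series (Suc r) s =
      (\<Sum>j<Suc r. (-1) ^ j * EZ_series (r - j) s * zeta_cont (of_nat (Suc j) * s))" for r
  proof (rule LIMSEQ_unique)
    show "(\<lambda>M. of_nat (Suc r) * esym (Suc r) (\<lambda>i. f (Suc i)) M) \<longlonglongrightarrow> of_nat (Suc r) * EZ_series (Suc r) s"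
      by (intro tendsto_intros lim)
    show "(\<lambda>M. of_nat (Suc r) * esym (Suc r) (\<lambda>i. f (Suc i)) M) \<longlonglongrightarrow>
      (\<Sum>j<Suc r. (-1) ^ j * EZ_series (r - j) s * zeta_cont (of_nat (Suc j) * s))"
      unfolding newton_identity diff_Suc_Suc by (intro tendsto_intros lim p)
  qed
  show ?thesis
  proof (induction r rule: less_induct)
    case (less r)
    show ?case
    proof (cases r)
      case 0
      have "EZ_indices 0 = {[]}" by (auto simp: EZ_indices_def)
      then show ?thesis using 0 by (simp add: EZ_series_def)
    next
      case (Suc n)
      have "multi_zeta r s = (\<Sum>j<Suc n. (-1) ^ j * EZ_series (n - j) s * zeta_cont (of_nat (Suc j) * s)) / of_nat (Suc n)"
        unfolding Suc multi_zeta.simps(2) using less Suc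
        by (intro arg_cong2[where f = "(/)"] sum.cong refl) auto
      also have "\<dots> = EZ_series r s"
        unfolding rec[symmetric] Suc by (simp del: of_nat_Suc)
      finally show ?thesis .
    qed
  qed
qed

lemma zeta_cont_scaled_meromorphic:
  "(\<lambda>s. zeta_cont (of_nat (Suc j) * s)) meromorphic_on UNIV"
  by (rule meromorphic_on_compose[OF zeta_cont_meromorphic]) (auto intro!: analytic_intros)

lemma multi_zeta_meromorphic: "multi_zeta r meromorphic_on UNIV"
proof (induction r rule: less_induct)
  case (less r)
  show ?case
  proof (cases r)
    case 0
    then show ?thesis by (simp add: meromorphic_on_const)
  next
    case (Suc n)
    have "(\<lambda>s. (\<Sum>j<Suc n. (-1) ^ j * multi_zeta (n - j) s * zeta_cont (of_nat (Suc j) * s)) / of_nat (Suc n))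
        meromorphic_on UNIV"
      using less Suc by (intro meromorphic_intros zeta_cont_scaled_meromorphic) auto
    then show ?thesis unfolding Suc multi_zeta.simps(2)[abs_def] .
  qed
qed

lemma multi_zeta_analytic:
  assumes s: "Re s > 1"
  shows "multi_zeta r analytic_on {s}"
proof (induction r rule: less_induct)
  case (less r)
  show ?case
  proof (cases r)
    case 0
    then show ?thesis by simp
  next
    case (Suc n)
    have z: "(\<lambda>s. zeta_cont (of_nat (Suc j) * s)) analytic_on {s}" for j
    proof -
      have "1 * 1 < real (Suc j) * Re s"
        using s by (intro mult_le_less_imp_less) auto
      then have "zeta_cont analytic_on (\<lambda>s. of_nat (Suc j) * s) ` {s}"
        using zeta_cont_analytic[of "of_nat (Suc j) * s"] by simp
      from analytic_on_compose[OF _ this] show ?thesis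
        by (simp add: o_def analytic_intros)
    qed
    have "(\<lambda>s. (\<Sum>j<Suc n. (-1) ^ j * multi_zeta (n - j) s * zeta_cont (of_nat (Suc j) * s)) / of_nat (Suc n))
        analytic_on {s}"
      using less Suc by (intro analytic_intros z) (auto simp del: of_nat_Suc)
    then show ?thesis unfolding Suc multi_zeta.simps(2)[abs_def] .
  qed
qed

text \<open>The identity theorem makes the difference vanish near every point, possibly except at
  the point itself. There the value is forced too: it is the limit, or 0 at a pole.\<close>

lemma nicely_meromorphic_unique:
  assumes F: "F nicely_meromorphic_on UNIV" and G: "G nicely_meromorphic_on UNIV"
    and eq: "\<And>s. Re s > a \<Longrightarrow> F s = G s"
  shows "F = G"
proof
  fix z
  define H where "H = remove_sings (\<lambda>s. F s - G s)"
  have mero: "(\<lambda>s. F s - G s) meromorphic_on UNIV"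
    using F G unfolding nicely_meromorphic_on_def by (intro meromorphic_on_diff) simp_all
  then have H: "H nicely_meromorphic_on UNIV"
    unfolding H_def by (rule remove_sings_nicely_meromorphic)
  have H_eq: "eventually (\<lambda>w. H w = F w - G w) (at z)" for z
    unfolding H_def using mero
    by (intro eventually_remove_sings_eq_at meromorphic_on_isolated_singularity[of _ z] meromorphic_on_subset[OF mero]) auto
  have "eventually (\<lambda>w. w \<in> {w. Re w > a}) (at (of_real (a + 1)))"
    by (intro eventually_at_in_open' open_halfspace_Re_gt) simp
  with H_eq[of "of_real (a + 1)"] have "eventually (\<lambda>w. H w = 0) (at (of_real (a + 1)))"
    by eventually_elim (simp add: eq)
  then have "frequently (\<lambda>w. H w = 0) (at (of_real (a + 1)))"
    by (intro eventually_frequently) simp_all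
  then have "H w = 0" for w
    by (rule frequently_eq_meromorphic_imp_constant[OF _ H]) (simp_all add: convex_connected)
  with H_eq[of z] have ev: "eventually (\<lambda>w. F w = G w) (at z)" by simp
  then have pole: "is_pole F z \<longleftrightarrow> is_pole G z" by (intro is_pole_cong) auto
  show "F z = G z"
  proof (cases "is_pole F z")
    case True
    then have "\<not> F \<midarrow>z\<rightarrow> F z" "\<not> G \<midarrow>z\<rightarrow> G z"
      using pole not_tendsto_and_filterlim_at_infinity[of "at z"] unfolding is_pole_def by auto
    then have "F z = 0" "G z = 0" using F G unfolding nicely_meromorphic_on_def by blast+
    then show ?thesis by simp
  next
    case False
    then have "F \<midarrow>z\<rightarrow> F z" "G \<midarrow>z\<rightarrow> G z"
      using F G pole unfolding nicely_meromorphic_on_def by auto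
    then show ?thesis using tendsto_cong[OF ev] LIM_unique by blast
  qed
qed

lemma EZ_zeta_eq: "EZ_zeta r = remove_sings (multi_zeta r)"
  unfolding EZ_zeta_def
proof (rule the_equality)
  show *: "remove_sings (multi_zeta r) nicely_meromorphic_on UNIV
      \<and> (\<forall>s. Re s > 1 \<longrightarrow> remove_sings (multi_zeta r) s = EZ_series r s)"
    by (simp add: remove_sings_nicely_meromorphic multi_zeta_meromorphic multi_zeta_analytic
        multi_zeta_eq_series)
  show "F = remove_sings (multi_zeta r)"
    if "F nicely_meromorphic_on UNIV \<and> (\<forall>s. Re s > 1 \<longrightarrow> F s = EZ_series r s)" for F
  proof (rule nicely_meromorphic_unique)
    show "F s = remove_sings (multi_zeta r) s" if "Re s > 1" for s
      using \<open>F nicely_meromorphic_on UNIV \<and> _\<close> * that by metis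
  qed (use that * in blast)+
qed

lemma multi_zeta_isolated: "isolated_singularity_at (multi_zeta r) z"
  by (rule meromorphic_on_isolated_singularity[OF meromorphic_on_subset[OF multi_zeta_meromorphic]]) auto

subsection \<open>Real zeros and poles\<close>

text \<open>
  Multiplied by the sign and the power of \<open>s - x\<close>, the \<open>j\<close>-th summand of Newton's identity tends to
  a nonnegative real, which is positive exactly if \<open>j = k\<close> (from the pole of \<open>\<zeta>\<close>) or \<open>j \<le> r mod k\<close>
  (from \<open>\<zeta> < 0\<close> on \<open>(0, 1)\<close>); one of these cases always occurs.
\<close>
lemma multi_zeta_limit:
  assumes x: "x > 0" and k: "k > 0" and small: "\<And>j. 0 < j \<Longrightarrow> j < k \<Longrightarrow> real j * x < 1"
    and "r < k \<or> real k * x = 1"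
  shows "\<exists>L>0. ((\<lambda>s. (-1) ^ (r + r div k) * (s - of_real x) ^ (r div k) * multi_zeta r s)
            \<longlongrightarrow> complex_of_real L) (at (of_real x))"
  using assms(4)
proof (induction r rule: less_induct)
  case (less r)
  define N where "N = (\<lambda>n s. (-1) ^ (n + n div k) * (s - of_real x) ^ (n div k) * multi_zeta n s)"
  show ?case
  proof (cases r)
    case 0
    then show ?thesis by (intro exI[of _ 1]) auto
  next
    case (Suc m)
    \<comment> \<open>The j-th summand of the recursion, normalized by the sign and the pole order
      expected of the whole sum.\<close>
    define T where "T = (\<lambda>j s. (-1) ^ (r + r div k) * (s - of_real x) ^ (r div k)
      * ((-1) ^ j * multi_zeta (m - j) s * zeta_cont (of_nat (Suc j) * s)))"
    have term_limit: "\<exists>t\<ge>0. (T j \<longlongrightarrow> complex_of_real t) (at (of_real x))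
        \<and> (Suc j = k \<or> Suc j \<le> r mod k \<longrightarrow> t > 0)" if j: "j \<le> m" for j
    proof -
      define i where "i = Suc j"
      have i: "0 < i" "i \<le> r" "m - j = r - i" using j Suc by (auto simp: i_def)
      obtain L where L: "L > 0" "(N (r - i) \<longlongrightarrow> of_real L) (at (of_real x))"
      proof -
        have "r - i < r" "r - i < k \<or> real k * x = 1" using i less.prems by auto
        from less.IH[OF this] that show ?thesis unfolding N_def by blast
      qed
      have lim_zeta: "((\<lambda>s. zeta_cont (of_nat i * s)) \<longlongrightarrow> zeta_cont (of_real (real i * x))) (at (of_real x))"
        if "real i * x \<noteq> 1"
      proof -
        have "complex_of_real (real i * x) \<noteq> 1" using that by (metis of_real_eq_1_iff)
        then have "zeta_cont analytic_on {of_real (real i * x)}"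
          by (intro zeta_cont_analytic disjI2 conjI Reals_of_real)
        then have "isCont zeta_cont (of_real (real i * x))"
          by (rule analytic_at_imp_isCont)
        then have "isCont zeta_cont (of_nat i * of_real x)" by simp
        moreover have "isCont (\<lambda>s. of_nat i * s) (complex_of_real x)"
          by (intro continuous_intros)
        ultimately have "isCont (\<lambda>s. zeta_cont (of_nat i * s)) (of_real x)"
          by (rule isCont_o2[rotated])
        then show ?thesis by (simp add: isCont_def)
      qed
      \<comment> \<open>In \<open>eq\<close> the pole of zeta supplies one order. In
        \<open>same\<close> the lower function already has the full pole order and zeta is negative.
        In \<open>lower\<close> the summand has too small a pole order and vanishes in the
        limit.\<close>
      consider (eq) "i = k" | (same) "i < k" "(r - i) div k = r div k"
        | (lower) "i \<noteq> k" "(r - i) div k < r div k"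
      proof (cases "i \<le> k")
        case True
        then show ?thesis using that div_le_mono[of "r - i" r k] by linarith
      next
        case False
        then have "r div k = Suc ((r - k) div k)" using i k by (simp add: le_div_geq)
        moreover have "(r - i) div k \<le> (r - k) div k" using False by (intro div_le_mono) auto
        ultimately show ?thesis using that False by linarith
      qed
      then show ?thesis
      proof cases
        case eq
        have kx: "real k * x = 1" using less.prems i eq by auto
        have d: "r div k = Suc ((r - i) div k)"
          using eq i k by (simp add: le_div_geq)
        obtain c where c: "c > 0" "((\<lambda>s. (s - 1) * zeta_cont s) \<longlongrightarrow> complex_of_real c) (at 1)"
          using zeta_cont_pole by auto
        have kx': "of_nat k * complex_of_real x = 1"
          using kx by (metis of_real_1 of_real_mult of_real_of_nat_eq)
        have "filterlim (\<lambda>s. of_nat k * s) (at 1) (at (complex_of_real x))"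
          unfolding filterlim_at
        proof
          show "\<forall>\<^sub>F s in at (complex_of_real x). of_nat k * s \<in> UNIV \<and> of_nat k * s \<noteq> 1"
          proof (rule eventually_mono[OF eventually_neq_at_within[of _ "of_real x"]])
            fix s assume "s \<noteq> complex_of_real x"
            then have "of_nat k * s \<noteq> of_nat k * complex_of_real x" using k by auto
            with kx' show "of_nat k * s \<in> UNIV \<and> of_nat k * s \<noteq> 1" by simp
          qed
          have "((\<lambda>s. of_nat k * s) \<longlongrightarrow> of_nat k * complex_of_real x) (at (of_real x))"
            by (intro tendsto_intros)
          then show "((\<lambda>s. of_nat k * s) \<longlongrightarrow> 1) (at (complex_of_real x))" unfolding kx' .
        qed
        from filterlim_compose[OF c(2) this]
        have "((\<lambda>s. N (r - i) s * ((of_nat k * s - 1) * zeta_cont (of_nat k * s)) / of_nat k)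
            \<longlongrightarrow> of_real L * of_real c / of_nat k) (at (of_real x))"
          using k by (intro tendsto_intros L) auto
        moreover have "N (r - i) s * ((of_nat k * s - 1) * zeta_cont (of_nat k * s)) / of_nat k = T j s" for s
        proof -
          have "of_nat k * s - 1 = of_nat k * (s - complex_of_real x)"
            using kx' by (simp add: right_diff_distrib)
          then have N: "N (r - i) s * ((of_nat k * s - 1) * zeta_cont (of_nat k * s)) / of_nat k
              = N (r - i) s * (s - of_real x) * zeta_cont (of_nat i * s)"
            using k eq by simp
          \<comment> \<open>Parity bookkeeping: the sign of the summand agrees with the normalizing
            sign of the lower function.\<close>
          have "r + r div k + j = (r - i + (r - i) div k) + 2 * i"
            using i d by (simp add: i_def)
          then have sign: "(-1 :: complex) ^ (r + r div k) * (-1) ^ j = (-1) ^ (r - i + (r - i) div k)"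
            by (simp only: power_add[symmetric]) (simp add: power_add)
          have "T j s = ((-1) ^ (r + r div k) * (-1) ^ j) * (s - of_real x) ^ (r div k)
              * multi_zeta (r - i) s * zeta_cont (of_nat i * s)"
            unfolding T_def i(3) i_def[symmetric] by (simp only: mult.assoc mult.left_commute)
          also have "\<dots> = N (r - i) s * (s - of_real x) * zeta_cont (of_nat i * s)"
            unfolding sign unfolding d N_def by (simp add: mult_ac)
          finally show ?thesis unfolding N by (rule sym)
        qed
        ultimately have "(T j \<longlongrightarrow> of_real (L * c / real k)) (at (of_real x))" by simp
        then show ?thesis using L c k by (intro exI[of _ "L * c / real k"]) auto
      next
        case same
        obtain y where y: "y < 0" "zeta_cont (of_real (real i * x)) = of_real y"
          using zeta_cont_neg[of "real i * x"] small[of i] same i x by auto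
        have "((\<lambda>s. N (r - i) s * - zeta_cont (of_nat i * s)) \<longlongrightarrow> of_real L * - of_real y) (at (of_real x))"
          using lim_zeta small[of i] same i unfolding y by (intro tendsto_intros L) auto
        moreover have "N (r - i) s * - zeta_cont (of_nat i * s) = T j s" for s
        proof -
          \<comment> \<open>Here the exponents differ by an odd number; the extra minus sign
            compensates for the negative value of zeta.\<close>
          have "Suc (r + r div k + j) = (r - i + (r - i) div k) + 2 * i"
            using i same by (simp add: i_def)
          then have "(-1 :: complex) ^ Suc (r + r div k + j) = (-1) ^ (r - i + (r - i) div k)"
            by (simp only:) (simp add: power_add)
          then have "(-1 :: complex) ^ (r - i + (r - i) div k) = - ((-1) ^ (r + r div k) * (-1) ^ j)"
            by (simp add: power_add)
          then show ?thesis
            unfolding N_def T_def i(3) same(2) by (simp add: i_def[symmetric])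
        qed
        ultimately have "(T j \<longlongrightarrow> of_real (L * - y)) (at (of_real x))" by simp
        then show ?thesis using L y mult_pos_neg[of L y] by (intro exI[of _ "L * - y"]) auto
      next
        case lower
        define d where "d = r div k - (r - i) div k"
        have d: "d > 0" "r div k = (r - i) div k + d" using lower by (auto simp: d_def)
        \<comment> \<open>The zeta factor stays finite: its argument is below 1 for
          \<open>i < k\<close> and above 1 for \<open>i > k\<close>.\<close>
        have "real i * x \<noteq> 1"
        proof (cases "i < k")
          case True
          then show ?thesis using small[of i] i by auto
        next
          case False
          then have "real k * x = 1" "k < i" using lower i less.prems by auto
          moreover have "real k * x < real i * x" using \<open>k < i\<close> x by simp
          ultimately show ?thesis by simp
        qed
        have not_le: "\<not> i \<le> r mod k"
        proof
          assume le: "i \<le> r mod k"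
          then have "r - i = (r mod k - i) + k * (r div k)"
            using mult_div_mod_eq[of k r] by linarith
          moreover have "r mod k - i < k" using k by (simp add: less_imp_diff_less)
          ultimately have "(r - i) div k = r div k" using k by simp
          with lower show False by simp
        qed
        have "((\<lambda>s. - ((-1) ^ d * (s - of_real x) ^ d * N (r - i) s * zeta_cont (of_nat i * s))) \<longlongrightarrow>
            - ((-1) ^ d * (of_real x - of_real x) ^ d * of_real L * zeta_cont (of_real (real i * x)))) (at (of_real x))"
          by (intro tendsto_intros L lim_zeta) fact
        moreover have "- ((-1) ^ d * (s - of_real x) ^ d * N (r - i) s * zeta_cont (of_nat i * s)) = T j s" for s
        proof -
          have "Suc (r + r div k + j) = (r - i + (r - i) div k) + d + 2 * i"
            using i d by (simp add: i_def)
          then have "(-1 :: complex) ^ Suc (r + r div k + j) = (-1) ^ (r - i + (r - i) div k) * (-1) ^ d"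
            by (simp only:) (simp add: power_add)
          then have "(-1) ^ d * (-1 :: complex) ^ (r - i + (r - i) div k) = - ((-1) ^ (r + r div k) * (-1) ^ j)"
            by (simp add: power_add)
          moreover have "(s - of_real x) ^ (r div k) = (s - of_real x) ^ ((r - i) div k) * (s - of_real x) ^ d"
            using d by (simp add: power_add)
          ultimately have "((-1) ^ d * (-1) ^ (r - i + (r - i) div k)) *
             ((s - of_real x) ^ d * (s - of_real x) ^ ((r - i) div k)) = 
             - ((-1) ^ (r + r div k) * (-1) ^ j) * (s - of_real x) ^ (r div k)" by simp
          then show ?thesis
            unfolding N_def T_def i(3) by (simp add: i_def[symmetric] algebra_simps)
        qed
        ultimately have "(T j \<longlongrightarrow> 0) (at (of_real x))" using d(1) by (simp add: power_0_left)
        then show ?thesis using lower not_le by (intro exI[of _ 0]) (auto simp: i_def)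
      qed
    qed
    then obtain t where t: "\<And>j. j \<le> m \<Longrightarrow> t j \<ge> 0"
      "\<And>j. j \<le> m \<Longrightarrow> (T j \<longlongrightarrow> complex_of_real (t j)) (at (of_real x))"
      "\<And>j. j \<le> m \<Longrightarrow> Suc j = k \<or> Suc j \<le> r mod k \<Longrightarrow> t j > 0"
      by metis
    \<comment> \<open>If \<open>k\<close> divides \<open>r\<close>, the polar summand
      \<open>j = k - 1\<close> is available; otherwise \<open>j = 0\<close> belongs to the range
      where zeta is negative.\<close>
    have "\<exists>j\<le>m. Suc j = k \<or> Suc j \<le> r mod k"
    proof (cases "r mod k = 0")
      case True
      then have "k \<le> r" using Suc by (auto dest: dvd_imp_le)
      then show ?thesis using Suc k by (intro exI[of _ "k - 1"]) auto
    qed (auto intro!: exI[of _ 0])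
    then obtain j where j: "j \<le> m" "t j > 0" using t(3) by blast
    then have pos: "(\<Sum>j<Suc m. t j) > 0"
      using t(1) by (intro sum_pos2[of _ j]) auto
    have "N r = (\<lambda>s. (\<Sum>j<Suc m. T j s) / of_nat (Suc m))"
      unfolding N_def T_def unfolding Suc multi_zeta.simps(2) sum_distrib_left[symmetric] by simp
    moreover have "((\<lambda>s. (\<Sum>j<Suc m. T j s) / of_nat (Suc m)) \<longlongrightarrow> (\<Sum>j<Suc m. of_real (t j)) / of_nat (Suc m)) (at (of_real x))"
      by (intro tendsto_intros t) (auto simp del: of_nat_Suc)
    ultimately have "(N r \<longlongrightarrow> of_real ((\<Sum>j<Suc m. t j) / real (Suc m))) (at (of_real x))"
      by (simp del: of_nat_Suc sum.lessThan_Suc)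
    then show ?thesis
      using pos unfolding N_def by (intro exI[of _ "(\<Sum>j<Suc m. t j) / real (Suc m)"]) (auto simp del: sum.lessThan_Suc)
  qed
qed

text \<open>Taking \<open>k = Suc r\<close> in \<open>multi_zeta_limit\<close> makes the exponent
  \<open>r div k\<close> zero, so the function itself has a nonzero limit.\<close>

lemma EZ_zeta_nonzero:
  assumes x: "x > 0" "real r * x < 1"
  shows "EZ_zeta r (of_real x) \<noteq> 0"
proof -
  have "real j * x < 1" if "j < Suc r" for j
  proof -
    have "real j * x \<le> real r * x" using that x by (intro mult_right_mono) auto
    with x show ?thesis by linarith
  qed
  then obtain L where L: "L > 0"
      "((\<lambda>s. (-1) ^ r * multi_zeta r s) \<longlongrightarrow> complex_of_real L) (at (of_real x))"
    using multi_zeta_limit[of x "Suc r" r] x by auto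
  have "((\<lambda>s. (-1) ^ r * ((-1) ^ r * multi_zeta r s)) \<longlongrightarrow> (-1) ^ r * complex_of_real L) (at (of_real x))"
    by (intro tendsto_intros L)
  then have "EZ_zeta r (of_real x) = (-1) ^ r * complex_of_real L"
    unfolding EZ_zeta_eq by (intro remove_sings_eqI) (simp add: mult.assoc[symmetric] power_add[symmetric])
  with L show ?thesis by simp
qed

text \<open>At 1/k the function times a positive power of \<open>s - x\<close> has a nonzero limit,
  so the function tends to infinity.\<close>

lemma EZ_zeta_is_pole:
  assumes k: "0 < k" "k \<le> r"
  shows "is_pole (EZ_zeta r) (of_real (1 / real k))"
proof -
  define x where "x = 1 / real k"
  define n where "n = r div k"
  have n: "n > 0" using k by (simp add: n_def div_greater_zero_iff)
  have x: "x > 0" "real k * x = 1" using k by (auto simp: x_def)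
  have "real j * x < 1" if "j < k" for j using that k by (simp add: x_def)
  then obtain L where L: "L > 0"
      "((\<lambda>s. (-1) ^ (r + n) * (s - of_real x) ^ n * multi_zeta r s) \<longlongrightarrow> complex_of_real L) (at (of_real x))"
    using multi_zeta_limit[of x k r] x k unfolding n_def by auto
  have "filterlim (\<lambda>s. (-1) ^ (r + n) * (s - of_real x) ^ n) (at 0) (at (complex_of_real x))"
    unfolding filterlim_at
  proof
    show "\<forall>\<^sub>F s in at (complex_of_real x). (-1) ^ (r + n) * (s - of_real x) ^ n \<in> UNIV
        \<and> (-1) ^ (r + n) * (s - of_real x) ^ n \<noteq> 0"
      by (rule eventually_mono[OF eventually_neq_at_within[of _ "of_real x"]]) auto
    have "((\<lambda>s. (-1) ^ (r + n) * (s - complex_of_real x) ^ n) \<longlongrightarrow> (-1) ^ (r + n) * (of_real x - of_real x) ^ n) (at (of_real x))"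
      by (intro tendsto_intros)
    then show "((\<lambda>s. (-1) ^ (r + n) * (s - complex_of_real x) ^ n) \<longlongrightarrow> 0) (at (of_real x))"
      using n by (simp add: power_0_left)
  qed
  from filterlim_divide_at_infinity[OF L(2) this] L(1)
  have "filterlim (\<lambda>s. ((-1) ^ (r + n) * (s - of_real x) ^ n * multi_zeta r s) / ((-1) ^ (r + n) * (s - of_real x) ^ n))
      at_infinity (at (complex_of_real x))" by simp
  then have "filterlim (multi_zeta r) at_infinity (at (complex_of_real x))"
  proof (rule filterlim_mono_eventually)
    show "\<forall>\<^sub>F s in at (complex_of_real x). ((-1) ^ (r + n) * (s - of_real x) ^ n * multi_zeta r s) / ((-1) ^ (r + n) * (s - of_real x) ^ n) = multi_zeta r s"
      by (rule eventually_mono[OF eventually_neq_at_within[of _ "of_real x"]]) auto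
  qed auto
  then show ?thesis
    unfolding EZ_zeta_eq x_def[symmetric]
    by (subst is_pole_remove_sings_iff[OF multi_zeta_isolated]) (simp only: is_pole_def)
qed

lemma EZ_real_zeros_decomp:
  "EZ_real_zeros r {0<..<1} = (\<Union>k\<in>{2..r}. EZ_real_zeros r {1 / real k <..< 1 / (real k - 1)})"
proof (intro equalityI subsetI)
  fix x assume x: "x \<in> EZ_real_zeros r {0<..<1}"
  then have x01: "0 < x" "x < 1" and zero: "EZ_zeta r (of_real x) = 0" "\<not> is_pole (EZ_zeta r) (of_real x)"
    by (auto simp: EZ_real_zeros_def)
  define k where "k = nat \<lceil>1 / x\<rceil>"
  \<comment> \<open>Rounding 1/x up locates \<open>x\<close> in the half-open interval from 1/k to
    1/(k-1); its left endpoint is excluded below as a pole.\<close>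
  have "1 / x > 1" using x01 by simp
  then have "\<lceil>1 / x\<rceil> \<ge> 2" by linarith
  then have k: "k \<ge> 2" "real k - 1 < 1 / x" "1 / x \<le> real k"
    unfolding k_def by linarith+
  then have lo: "1 / real k \<le> x" and hi: "x < 1 / (real k - 1)"
    using x01 by (simp_all add: field_simps)
  have "k \<le> r"
  proof (rule ccontr)
    assume "\<not> k \<le> r"
    then have "real r \<le> real k - 1" by linarith
    then have "real r * x \<le> (real k - 1) * x" using x01 by (intro mult_right_mono) auto
    also have "\<dots> < 1" using k x01 by (simp add: field_simps)
    finally have "real r * x < 1" .
    with EZ_zeta_nonzero x01 zero show False by blast
  qed
  have "x \<noteq> 1 / real k"
    using EZ_zeta_is_pole[of k r] \<open>k \<le> r\<close> k zero by auto
  with lo hi zero \<open>k \<le> r\<close> k show "x \<in> (\<Union>k\<in>{2..r}. EZ_real_zeros r {1 / real k <..< 1 / (real k - 1)})"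
    by (auto simp: EZ_real_zeros_def intro!: bexI[of _ k])
next
  fix x assume "x \<in> (\<Union>k\<in>{2..r}. EZ_real_zeros r {1 / real k <..< 1 / (real k - 1)})"
  then obtain k where k: "k \<ge> 2" "1 / real k < x" "x < 1 / (real k - 1)"
    "EZ_zeta r (of_real x) = 0" "\<not> is_pole (EZ_zeta r) (of_real x)"
    by (auto simp: EZ_real_zeros_def)
  have "0 < 1 / real k" "1 / (real k - 1) \<le> 1" using k by auto
  then have "0 < x" "x < 1" using k by linarith+
  with k show "x \<in> EZ_real_zeros r {0<..<1}" by (simp add: EZ_real_zeros_def)
qed

lemma disjoint_reciprocal_intervals:
  assumes "2 \<le> k" "k < (l::nat)"
  shows "{1 / real k <..< 1 / (real k - 1)} \<inter> {1 / real l <..< 1 / (real l - 1)} = {}"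
proof -
  have "1 / (real l - 1) \<le> 1 / real k" using assms by (intro divide_left_mono) auto
  then show ?thesis by auto
qed

subsection \<open>Dirichlet's divisor estimate\<close>

lemma card_hyperbola:
  "(\<Sum>k=1..r. r div k) = card {(a::nat, b::nat). 1 \<le> a \<and> 1 \<le> b \<and> a * b \<le> r}"
proof -
  have "{(a::nat, b::nat). 1 \<le> a \<and> 1 \<le> b \<and> a * b \<le> r} = (SIGMA a:{1..r}. {1..r div a})"
  proof (intro set_eqI iffI; clarsimp)
    fix a b :: nat assume "Suc 0 \<le> a" "Suc 0 \<le> b" "a * b \<le> r"
    moreover from this have "a \<le> a * b" by simp
    then have "a \<le> r" using \<open>a * b \<le> r\<close> by (rule order_trans)
    ultimately show "a \<le> r \<and> b \<le> r div a"
      by (auto simp: less_eq_div_iff_mult_less_eq mult.commute)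
  next
    fix a b :: nat assume "Suc 0 \<le> a" "a \<le> r" "Suc 0 \<le> b" "b \<le> r div a"
    then show "a * b \<le> r" by (auto simp: less_eq_div_iff_mult_less_eq mult.commute)
  qed
  then show ?thesis by simp
qed

text \<open>A lattice point under the hyperbola has a coordinate at most \<open>m\<close>, since
  otherwise the product is at least (m+1)^2. The two resulting regions are mirror images and overlap
  exactly in the m by m square.\<close>

lemma hyperbola_method:
  assumes "m\<^sup>2 \<le> r" "r < (Suc m)\<^sup>2"
  shows "(\<Sum>k=1..r. r div k) + m\<^sup>2 = 2 * (\<Sum>k=1..m. r div k)"
proof -
  let ?H = "{(a::nat, b::nat). 1 \<le> a \<and> 1 \<le> b \<and> a * b \<le> r}"
  let ?A = "SIGMA a:{1..m}. {1..r div a}"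
  let ?B = "prod.swap ` ?A"
  have A: "?A = {(a, b) \<in> ?H. a \<le> m}"
    by (auto simp: less_eq_div_iff_mult_less_eq mult.commute)
  have B: "?B = {(a, b) \<in> ?H. b \<le> m}"
    unfolding A by (auto simp: image_iff mult.commute)
  have small: "a \<le> m \<or> b \<le> m" if "a * b \<le> r" for a b
  proof (rule ccontr)
    assume "\<not> (a \<le> m \<or> b \<le> m)"
    then have "Suc m * Suc m \<le> a * b" by (intro mult_le_mono) auto
    with that assms show False by (simp add: power2_eq_square)
  qed
  have un: "?A \<union> ?B = ?H" unfolding B unfolding A using small by blast
  have int: "?A \<inter> ?B = {1..m} \<times> {1..m}"
  proof -
    have "a * b \<le> r" if "a \<le> m" "b \<le> m" for a b
      using mult_le_mono[OF that] assms by (simp add: power2_eq_square)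
    then show ?thesis unfolding B unfolding A by auto
  qed
  have fin: "finite ?A" by auto
  have "card ?H + card ({1..m} \<times> {1..m}) = card ?A + card ?B"
    using card_Un_Int[of ?A ?B] fin unfolding un int by simp
  moreover have "card ?B = card ?A" by (intro card_image) (auto simp: inj_on_def)
  moreover have "card ?A = (\<Sum>k=1..m. r div k)" by simp
  ultimately show ?thesis
    unfolding card_hyperbola by (simp only: card_cartesian_product power2_eq_square) simp
qed

text \<open>The known two-sided bounds compare \<open>harm n\<close> with ln(n+1) and err on one
  side; replacing this by ln n errs on the other side, each time by at most 1/n.\<close>

lemma harm_error:
  assumes "n \<ge> 1"
  shows "\<bar>harm n - ln (real n) - euler_mascheroni\<bar> \<le> 1 / real n"
proof -
  define L where "L = ln (real (n + 1))"
  have "harm n - L + inverse (real (2 * (n + 1))) \<le> euler_mascheroni"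
       "euler_mascheroni \<le> harm n - L + inverse (real (2 * n))"
    using euler_mascheroni_upper[of "n - 1"] euler_mascheroni_lower[of "n - 1"] assms
    by (simp_all add: L_def field_simps)
  moreover have "0 \<le> inverse (real (2 * (n + 1)))" "inverse (real (2 * n)) \<le> 1 / real n"
    using assms by (auto simp: field_simps)
  ultimately have "harm n - L \<le> euler_mascheroni" "euler_mascheroni \<le> harm n - L + 1 / real n"
    by linarith+
  moreover have "L - ln (real n) \<le> 1 / real n" "ln (real n) \<le> L"
    using ln_diff_le[of "real (n + 1)" "real n"] assms by (auto simp: L_def field_simps)
  ultimately show ?thesis by linarith
qed

lemma sum_floor_error:
  fixes r m :: nat
  shows "\<bar>(\<Sum>k=1..m. real (r div k)) - real r * harm m\<bar> \<le> real m"
proof -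
  have "\<bar>real (r div k) - real r / real k\<bar> \<le> 1" if "k \<ge> 1" for k
  proof -
    have "real r / real k = real (r div k) + real (r mod k) / real k"
      using that by (simp add: field_simps flip: of_nat_mult of_nat_add)
    moreover have "real (r mod k) / real k \<le> 1" using that by (auto simp: less_imp_le)
    ultimately show ?thesis by simp
  qed
  then have "(\<Sum>k=1..m. \<bar>real (r div k) - real r / real k\<bar>) \<le> (\<Sum>k=1..m. 1)"
    by (intro sum_mono) auto
  moreover have "\<bar>\<Sum>k=1..m. real (r div k) - real r / real k\<bar> \<le> (\<Sum>k=1..m. \<bar>real (r div k) - real r / real k\<bar>)"
    by (rule sum_abs)
  moreover have "(\<Sum>k=1..m. real (r div k) - real r / real k) = (\<Sum>k=1..m. real (r div k)) - real r * harm m"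
    by (simp add: sum_subtractf harm_def sum_distrib_left divide_inverse)
  ultimately show ?thesis by (simp only: sum_constant card_atLeastAtMost)
qed

lemma dirichlet_divisor_error:
  assumes "r \<ge> 1"
  shows "\<bar>real (\<Sum>k=1..r. r div k) - (real r * ln (real r) + (2 * euler_mascheroni - 1) * real r)\<bar>
           \<le> 18 * sqrt (real r)"
proof -
  define m where "m = floor_sqrt r"
  have m: "m\<^sup>2 \<le> r" "r < (Suc m)\<^sup>2" "m \<ge> 1"
    using assms by (auto simp: m_def floor_sqrt_power2_le Suc_floor_sqrt_power2_gt Suc_le_eq)
  define R M where "R = real r" and "M = real m"
  have M: "M \<ge> 1" "M\<^sup>2 \<le> R" "R \<le> M\<^sup>2 + 2 * M"
  proof -
    show "M \<ge> 1" using m by (simp add: M_def)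
    show "M\<^sup>2 \<le> R" using m(1) unfolding M_def R_def by (metis of_nat_le_iff of_nat_power)
    have "r \<le> m\<^sup>2 + 2 * m" using m(2) by (simp add: power2_eq_square)
    then show "R \<le> M\<^sup>2 + 2 * M" unfolding M_def R_def
      by (metis of_nat_add of_nat_le_iff of_nat_mult of_nat_numeral of_nat_power)
  qed
  have R3: "R \<le> 3 * M\<^sup>2" using M by (simp add: power2_eq_square) (smt (verit) mult_le_cancel_left1)
  have S: "real (\<Sum>k=1..r. r div k) = 2 * (\<Sum>k=1..m. real (r div k)) - M\<^sup>2"
    using arg_cong[OF hyperbola_method[OF m(1,2)], of real] by (simp add: M_def)
  have e1: "\<bar>(\<Sum>k=1..m. real (r div k)) - R * harm m\<bar> \<le> M"
    unfolding R_def M_def by (rule sum_floor_error)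
  have e2: "\<bar>R * harm m - R * (ln M + euler_mascheroni)\<bar> \<le> 3 * M"
  proof -
    have "\<bar>R * (harm m - ln M - euler_mascheroni)\<bar> \<le> R * (1 / M)"
      unfolding abs_mult using harm_error[OF m(3)] by (intro mult_mono) (auto simp: R_def M_def)
    also have "\<dots> \<le> 3 * M" using R3 M by (simp add: field_simps power2_eq_square)
    finally show ?thesis by (simp add: algebra_simps)
  qed
  have e3: "\<bar>R * (2 * ln M) - R * ln R\<bar> \<le> 6 * M"
  proof -
    have "2 * ln M = ln (M\<^sup>2)" using M by (simp add: ln_realpow)
    moreover have "ln (M\<^sup>2) \<le> ln R" using M zero_less_power[of M 2] by (intro ln_mono) linarith+
    moreover have "ln R - ln (M\<^sup>2) \<le> (R - M\<^sup>2) / M\<^sup>2"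
      using M zero_less_power[of M 2] less_le_trans[of 0 "M\<^sup>2" R] by (intro ln_diff_le) linarith+
    moreover have "(R - M\<^sup>2) / M\<^sup>2 \<le> 2 * M / M\<^sup>2" using M by (intro divide_right_mono) auto
    ultimately have "\<bar>2 * ln M - ln R\<bar> \<le> 2 / M" using M by (simp add: power2_eq_square)
    then have "R * \<bar>2 * ln M - ln R\<bar> \<le> (3 * M\<^sup>2) * (2 / M)"
      using R3 by (intro mult_mono) auto
    also have "\<dots> = 6 * M" using M by (simp add: power2_eq_square)
    finally have "\<bar>R * (2 * ln M - ln R)\<bar> \<le> 6 * M" by (simp add: abs_mult R_def)
    then show ?thesis by (simp add: algebra_simps)
  qed
  \<comment> \<open>The constant is 2 + 6 + 6 + 2: twice \<open>e1\<close>, twice \<open>e2\<close>,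
    then \<open>e3\<close>, and finally the replacement of \<open>M\<^sup>2\<close> by
    \<open>R\<close>.\<close>
  have "\<bar>real (\<Sum>k=1..r. r div k) - (R * ln R + (2 * euler_mascheroni - 1) * R)\<bar> \<le> 16 * M"
    using e1 e2 e3 M unfolding S by (simp add: algebra_simps)
  also have "16 * M \<le> 18 * sqrt R" using M real_le_rsqrt[OF M(2)] by linarith
  finally show ?thesis by (simp add: R_def)
qed

text \<open>Dropping the term \<open>k = 1\<close>, which equals \<open>r\<close>, turns the
  coefficient 2\<gamma> - 1 into 2\<gamma> - 2.\<close>

lemma sum_div_asymp:
  "(\<lambda>r::nat. real (\<Sum>k=2..r. r div k) - (real r * ln (real r) - 2 * (1 - euler_mascheroni) * real r))
      \<in> O(\<lambda>r. real r powr (1/2))"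
proof (rule bigoI[where c = 18], rule eventually_mono[OF eventually_ge_at_top[of 1]])
  fix r :: nat assume r: "r \<ge> 1"
  then have "(\<Sum>k=1..r. r div k) = r + (\<Sum>k=2..r. r div k)"
    by (simp add: sum.atLeast_Suc_atMost numeral_2_eq_2)
  then have *: "real (\<Sum>k=2..r. r div k) = real (\<Sum>k=1..r. r div k) - real r"
    by (simp only: of_nat_add)
  show "norm (real (\<Sum>k=2..r. r div k) - (real r * ln (real r) - 2 * (1 - euler_mascheroni) * real r))
      \<le> 18 * norm (real r powr (1/2))"
    using dirichlet_divisor_error[OF r] unfolding * by (simp add: powr_half_sqrt algebra_simps)
qed

subsection \<open>Counting the zeros\<close>

theorem theorem4:
  assumes simple: "\<And>(r::nat) (x::real). 2 \<le> r \<Longrightarrow> x \<in> EZ_real_zeros r {0<..<1}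
      \<Longrightarrow> zorder (EZ_zeta r) (of_real x) = 1"
    and number: "\<And>(r::nat) (k::nat). 2 \<le> k \<Longrightarrow> k \<le> r
      \<Longrightarrow> card (EZ_real_zeros r {1 / real k <..< 1 / (real k - 1)}) = r div k"
  shows "(\<forall>r\<ge>2. IAZ r = (\<Sum>k=2..r. r div k)) \<and>
    (\<lambda>r::nat. real (IAZ r) - (real r * ln (real r) - 2 * (1 - euler_mascheroni) * real r))
      \<in> O(\<lambda>r. real r powr (1/2))"
proof
  show *: "\<forall>r\<ge>2. IAZ r = (\<Sum>k=2..r. r div k)"
  proof (intro allI impI)
    fix r :: nat
    have "IAZ r = card (\<Union>k\<in>{2..r}. EZ_real_zeros r {1 / real k <..< 1 / (real k - 1)})"
      unfolding IAZ_def by (simp only: EZ_real_zeros_decomp)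
    also have "\<dots> = (\<Sum>k=2..r. card (EZ_real_zeros r {1 / real k <..< 1 / (real k - 1)}))"
    proof (rule card_UN_disjoint)
      show "\<forall>k\<in>{2..r}. finite (EZ_real_zeros r {1 / real k <..< 1 / (real k - 1)})"
      proof
        fix k assume "k \<in> {2..r}"
        \<comment> \<open>An infinite set has cardinality 0 by convention, whereas
          \<open>r div k\<close> is at least 1; so the assumed count itself yields
          finiteness.\<close>
        then have "card (EZ_real_zeros r {1 / real k <..< 1 / (real k - 1)}) > 0"
          by (simp add: number div_greater_zero_iff)
        then show "finite (EZ_real_zeros r {1 / real k <..< 1 / (real k - 1)})"
          by (rule card_ge_0_finite)
      qed
      have sub: "EZ_real_zeros r I \<inter> EZ_real_zeros r J = {}" if "I \<inter> J = {}" for I J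
        using that by (auto simp: EZ_real_zeros_def)
      show "\<forall>k\<in>{2..r}. \<forall>l\<in>{2..r}. k \<noteq> l \<longrightarrow>
          EZ_real_zeros r {1 / real k <..< 1 / (real k - 1)} \<inter>
          EZ_real_zeros r {1 / real l <..< 1 / (real l - 1)} = {}"
      proof (intro ballI impI sub)
        fix k l assume "k \<in> {2..r}" "l \<in> {2..r}" "k \<noteq> l"
        then show "{1 / real k <..< 1 / (real k - 1)} \<inter> {1 / real l <..< 1 / (real l - 1)} = {}"
          using disjoint_reciprocal_intervals[of k l] disjoint_reciprocal_intervals[of l k]
          by (cases "k < l") (simp_all add: Int_commute)
      qed
    qed simp
    also have "\<dots> = (\<Sum>k=2..r. r div k)" by (intro sum.cong) (auto simp: number)
    finally show "IAZ r = (\<Sum>k=2..r. r div k)" .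
  qed
  have "eventually (\<lambda>r. real (\<Sum>k=2..r. r div k) - (real r * ln (real r) - 2 * (1 - euler_mascheroni) * real r)
      = real (IAZ r) - (real r * ln (real r) - 2 * (1 - euler_mascheroni) * real r)) sequentially"
    using eventually_ge_at_top[of 2] by eventually_elim (simp add: *)
  from landau_o.big.in_cong[OF this] sum_div_asymp
  show "(\<lambda>r::nat. real (IAZ r) - (real r * ln (real r) - 2 * (1 - euler_mascheroni) * real r))
      \<in> O(\<lambda>r. real r powr (1/2))" by simp
qed

end
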